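(* Let $m\ge2$ and let $X$ be a finite nonempty $C_m$-set with orbit decomposition $$X=\coprod_{\alpha\in I}C_m/H_\alpha,\qquad \ell_\alpha=[C_m:H_\alpha].$$ For each ordered pair $(\alpha,\beta)\in I\times I$, the diagonal action of $C_m$ on $C_m/H_\alpha\times C_m/H_\beta$ has $\gcd(\ell_\alpha,\ell_\beta)$ orbits, and every such orbit has length $\operatorname{lcm}(\ell_\alpha,\ell_\beta)$ and stabilizer $H_\alpha\cap H_\beta$. Consequently $d_X:=\gcd\{|O|:O\in(X\times X)/C_m\}$ satisfies $$d_X=\gcd_{\alpha\in I}\ell_\alpha=[C_m:\langle H_\alpha:\alpha\in I\rangle].$$ If $k$ is an algebraically closed field of characteristic $p\ge0$, then the number $$N_X:=\sum_{O\in(X\times X)/C_m}|H_O|_{p'}$$ (with $H_O$ the stabilizer of a point of $O$) satisfies $$N_X=\sum_{\alpha,\beta\in I}\gcd(\ell_\alpha,\ell_\beta)\,|H_\alpha\cap H_\beta|_{p'}.$$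
   Context: $C_m$ is the cyclic group of order $m$, acting diagonally on $X\times X$; $(X\times X)/C_m$ is the set of orbits. For a finite cyclic group $H$, $|H|_{p'}$ is the order of its maximal prime-to-$p$ quotient, with $|H|_{0'}=|H|$. *)

theory Defs
  imports "HOL-Algebra.Algebra" "HOL-Algebra.Left_Coset" "HOL-Computational_Algebra.Polynomial"
begin

definition subgroup_index :: "('a, 'b) monoid_scheme \<Rightarrow> 'a set \<Rightarrow> nat"
  where "subgroup_index G H = card (lcosets\<^bsub>G\<^esub> H)"

text \<open>Actions in the sense of \<^locale>\<open>group_action\<close> are families of extensional bijections,
  hence the restrictions to the underlying sets below.\<close>

definition coset_action :: "('a, 'b) monoid_scheme \<Rightarrow> 'a set \<Rightarrow> 'a \<Rightarrow> 'a set \<Rightarrow> 'a set"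
  where "coset_action G H g = (\<lambda>C \<in> lcosets\<^bsub>G\<^esub> H. g <#\<^bsub>G\<^esub> C)"

definition diagonal_action ::
    "'x set \<Rightarrow> ('a \<Rightarrow> 'x \<Rightarrow> 'x) \<Rightarrow> 'y set \<Rightarrow> ('a \<Rightarrow> 'y \<Rightarrow> 'y) \<Rightarrow> 'a \<Rightarrow> 'x \<times> 'y \<Rightarrow> 'x \<times> 'y"
  where "diagonal_action E \<phi> F \<psi> g = (\<lambda>z \<in> E \<times> F. (\<phi> g (fst z), \<psi> g (snd z)))"

definition coproduct_action ::
    "'i set \<Rightarrow> ('i \<Rightarrow> 'x set) \<Rightarrow> ('i \<Rightarrow> 'a \<Rightarrow> 'x \<Rightarrow> 'x) \<Rightarrow> 'a \<Rightarrow> 'i \<times> 'x \<Rightarrow> 'i \<times> 'x"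
  where "coproduct_action I E \<phi> g = (\<lambda>z \<in> Sigma I E. (fst z, \<phi> (fst z) g (snd z)))"

definition gset_iso ::
    "('a, 'b) monoid_scheme \<Rightarrow> 'x set \<Rightarrow> ('a \<Rightarrow> 'x \<Rightarrow> 'x) \<Rightarrow> 'y set \<Rightarrow> ('a \<Rightarrow> 'y \<Rightarrow> 'y) \<Rightarrow> ('x \<Rightarrow> 'y) \<Rightarrow> bool"
  where "gset_iso G E \<phi> F \<psi> f \<longleftrightarrow>
    bij_betw f E F \<and> (\<forall>g \<in> carrier G. \<forall>x \<in> E. f (\<phi> g x) = \<psi> g (f x))"

definition orbit_decomposition ::
    "('a, 'b) monoid_scheme \<Rightarrow> 'x set \<Rightarrow> ('a \<Rightarrow> 'x \<Rightarrow> 'x) \<Rightarrow> 'i set \<Rightarrow> ('i \<Rightarrow> 'a set) \<Rightarrow> bool"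
  where "orbit_decomposition G E \<phi> I H \<longleftrightarrow>
    (\<forall>\<alpha> \<in> I. subgroup (H \<alpha>) G) \<and>
    (\<exists>f. gset_iso G
           (SIGMA \<alpha>:I. lcosets\<^bsub>G\<^esub> (H \<alpha>))
           (coproduct_action I (\<lambda>\<alpha>. lcosets\<^bsub>G\<^esub> (H \<alpha>)) (\<lambda>\<alpha>. coset_action G (H \<alpha>)))
           E \<phi> f)"

abbreviation pair_orbits :: "('a, 'b) monoid_scheme \<Rightarrow> 'x set \<Rightarrow> ('a \<Rightarrow> 'x \<Rightarrow> 'x) \<Rightarrow> ('x \<times> 'x) set set"
  where "pair_orbits G E \<phi> \<equiv> orbits G (E \<times> E) (diagonal_action E \<phi> E \<phi>)"

definition pair_orbit_gcd :: "('a, 'b) monoid_scheme \<Rightarrow> 'x set \<Rightarrow> ('a \<Rightarrow> 'x \<Rightarrow> 'x) \<Rightarrow> nat"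
  where "pair_orbit_gcd G E \<phi> = Gcd {card Orb | Orb. Orb \<in> pair_orbits G E \<phi>}"

text \<open>The order of the maximal prime-to-\<open>p\<close> quotient of a finite cyclic group \<open>H\<close>. The case
  \<open>p = 0\<close> is separate because \<open>coprime n 0\<close> only holds for \<open>n = 1\<close>.\<close>

definition prime_to_order :: "nat \<Rightarrow> ('a, 'b) monoid_scheme \<Rightarrow> nat"
  where "prime_to_order p H =
    (if p = 0 then Coset.order H
     else Max {Coset.order (H Mod N) | N. N \<lhd> H \<and> coprime (Coset.order (H Mod N)) p})"

text \<open>The stabilizer of a chosen point of an orbit; for commutative groups the choice is
  irrelevant, see \<open>orbit_stabilizer_eq\<close> below.\<close>

definition orbit_stabilizer :: "('a, 'b) monoid_scheme \<Rightarrow> ('a \<Rightarrow> 'x \<Rightarrow> 'x) \<Rightarrow> 'x set \<Rightarrow> 'a set"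
  where "orbit_stabilizer G \<phi> Orb = stabilizer G \<phi> (SOME x. x \<in> Orb)"

definition pair_orbit_number :: "nat \<Rightarrow> ('a, 'b) monoid_scheme \<Rightarrow> 'x set \<Rightarrow> ('a \<Rightarrow> 'x \<Rightarrow> 'x) \<Rightarrow> nat"
  where "pair_orbit_number p G E \<phi> =
    (\<Sum>Orb \<in> pair_orbits G E \<phi>.
       prime_to_order p (G\<lparr>carrier := orbit_stabilizer G (diagonal_action E \<phi> E \<phi>) Orb\<rparr>))"

lemma group_actionI:
  assumes "group G"
    and ext: "\<And>g. g \<in> carrier G \<Longrightarrow> \<phi> g \<in> extensional E"
    and cl: "\<And>g x. g \<in> carrier G \<Longrightarrow> x \<in> E \<Longrightarrow> \<phi> g x \<in> E"
    and one: "\<And>x. x \<in> E \<Longrightarrow> \<phi> \<one>\<^bsub>G\<^esub> x = x"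
    and mult: "\<And>g h x. g \<in> carrier G \<Longrightarrow> h \<in> carrier G \<Longrightarrow> x \<in> E \<Longrightarrow> \<phi> (g \<otimes>\<^bsub>G\<^esub> h) x = \<phi> g (\<phi> h x)"
  shows "group_action G E \<phi>"
proof -
  interpret group G by fact
  have bij: "\<phi> g \<in> Bij E" if g: "g \<in> carrier G" for g
  proof -
    have "bij_betw (\<phi> g) E E"
    proof (rule bij_betwI[where g = "\<phi> (inv\<^bsub>G\<^esub> g)"])
      show "\<phi> (inv\<^bsub>G\<^esub> g) (\<phi> g x) = x" if "x \<in> E" for x
        using that g mult[of "inv\<^bsub>G\<^esub> g" g x] one by simp
      show "\<phi> g (\<phi> (inv\<^bsub>G\<^esub> g) x) = x" if "x \<in> E" for x
        using that g mult[of g "inv\<^bsub>G\<^esub> g" x] one by simp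
    qed (use g cl in auto)
    then show ?thesis using ext g by (simp add: Bij_def)
  qed
  have "\<phi> (g \<otimes>\<^bsub>G\<^esub> h) = compose E (\<phi> g) (\<phi> h)" if "g \<in> carrier G" "h \<in> carrier G" for g h
    using that ext mult by (intro extensionalityI[of _ E]) (auto simp: compose_def)
  then have "\<phi> \<in> hom G (BijGroup E)"
    using bij by (auto simp: hom_def BijGroup_def)
  then show ?thesis
    by (intro group_action.intro group_hom.intro group_hom_axioms.intro group_BijGroup assms(1))
qed

lemma group_action_coset_action:
  assumes "group G" "subgroup H G"
  shows "group_action G (lcosets\<^bsub>G\<^esub> H) (coset_action G H)"
proof -
  interpret group G by fact
  note H = subgroup.subset[OF assms(2)]
  have cl: "g <#\<^bsub>G\<^esub> C \<in> lcosets\<^bsub>G\<^esub> H" if gC: "g \<in> carrier G" "C \<in> lcosets\<^bsub>G\<^esub> H" for g C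
  proof -
    obtain a where a: "a \<in> carrier G" "C = a <#\<^bsub>G\<^esub> H"
      using gC(2) by (auto simp: LCOSETS_def)
    have "g <#\<^bsub>G\<^esub> C = (g \<otimes>\<^bsub>G\<^esub> a) <#\<^bsub>G\<^esub> H"
      using a gC(1) H by (simp add: lcos_m_assoc)
    then show ?thesis using a gC(1) unfolding LCOSETS_def by blast
  qed
  have sub: "C \<subseteq> carrier G" if "C \<in> lcosets\<^bsub>G\<^esub> H" for C
    using that subgroup.lcosets_carrier[OF assms(2,1)] by blast
  show ?thesis
  proof (rule group_actionI[OF assms(1)])
    fix g assume "g \<in> carrier G"
    show "coset_action G H g \<in> extensional (lcosets\<^bsub>G\<^esub> H)"
      by (simp add: coset_action_def)
  next
    fix g C assume "g \<in> carrier G" "C \<in> lcosets\<^bsub>G\<^esub> H"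
    then show "coset_action G H g C \<in> lcosets\<^bsub>G\<^esub> H"
      by (simp add: coset_action_def cl)
  next
    fix C assume "C \<in> lcosets\<^bsub>G\<^esub> H"
    then show "coset_action G H \<one>\<^bsub>G\<^esub> C = C"
      by (simp add: coset_action_def lcos_mult_one sub)
  next
    fix g h C assume "g \<in> carrier G" "h \<in> carrier G" "C \<in> lcosets\<^bsub>G\<^esub> H"
    then show "coset_action G H (g \<otimes>\<^bsub>G\<^esub> h) C = coset_action G H g (coset_action G H h C)"
      by (simp add: coset_action_def cl lcos_m_assoc sub)
  qed
qed

lemma group_actionE:
  assumes "group_action G E \<phi>"
  shows "group G"
    and "\<And>g x. g \<in> carrier G \<Longrightarrow> x \<in> E \<Longrightarrow> \<phi> g x \<in> E"
    and "\<And>x. x \<in> E \<Longrightarrow> \<phi> \<one>\<^bsub>G\<^esub> x = x"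
    and "\<And>g h x. g \<in> carrier G \<Longrightarrow> h \<in> carrier G \<Longrightarrow> x \<in> E \<Longrightarrow> \<phi> (g \<otimes>\<^bsub>G\<^esub> h) x = \<phi> g (\<phi> h x)"
proof -
  interpret group_action G E \<phi> by fact
  show "group G" using group_hom group_hom.axioms(1) by blast
  show "\<phi> g x \<in> E" if "g \<in> carrier G" "x \<in> E" for g x
    using element_image[OF that refl] .
  show "\<phi> \<one>\<^bsub>G\<^esub> x = x" if "x \<in> E" for x
    using that by (simp flip: id_eq_one)
  show "\<phi> (g \<otimes>\<^bsub>G\<^esub> h) x = \<phi> g (\<phi> h x)" if "g \<in> carrier G" "h \<in> carrier G" "x \<in> E" for g h x
    using composition_rule[OF that(3,1,2)] .
qed

lemma group_action_diagonal_action: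
  assumes "group_action G E \<phi>" "group_action G F \<psi>"
  shows "group_action G (E \<times> F) (diagonal_action E \<phi> F \<psi>)"
  by (rule group_actionI[OF group_actionE(1)[OF assms(1)]])
    (auto simp: diagonal_action_def group_actionE[OF assms(1)] group_actionE[OF assms(2)])

lemma group_action_coproduct_action:
  assumes "group G" "\<And>\<alpha>. \<alpha> \<in> I \<Longrightarrow> group_action G (E \<alpha>) (\<phi> \<alpha>)"
  shows "group_action G (Sigma I E) (coproduct_action I E \<phi>)"
  by (rule group_actionI[OF assms(1)])
    (auto simp: coproduct_action_def group_actionE(2-4)[OF assms(2)])

lemma orbit_stabilizer_eq:
  assumes "comm_group G" "group_action G E \<phi>" "Orb \<in> orbits G E \<phi>" "x \<in> Orb"
  shows "orbit_stabilizer G \<phi> Orb = stabilizer G \<phi> x"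
proof -
  interpret comm_group G by fact
  interpret group_action G E \<phi> by fact
  obtain z where z: "z \<in> E" "Orb = orbit G \<phi> z"
    using assms(3) by (auto simp: orbits_def)
  have "stabilizer G \<phi> y = stabilizer G \<phi> z" if y: "y \<in> Orb" for y
  proof -
    obtain g where g: "g \<in> carrier G" "y = \<phi> g z"
      using y z by (auto simp: orbit_def)
    have "\<phi> h (\<phi> g z) = \<phi> g z \<longleftrightarrow> \<phi> h z = z" if h: "h \<in> carrier G" for h
    proof -
      have "\<phi> h (\<phi> g z) = \<phi> g (\<phi> h z)"
        using h g z composition_rule[of z h g] composition_rule[of z g h] by (simp add: m_comm)
      then show ?thesis
        using inj_prop[OF g(1)] element_image[OF h z(1) refl] z(1) by (auto dest: inj_onD)
    qed
    then show ?thesis using g by (auto simp: stabilizer_def)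
  qed
  then show ?thesis
    unfolding orbit_stabilizer_def using assms(4) by (metis someI)
qed

end

theory Submission
  imports Defs
begin

text \<open>Everything is controlled by indices. In a cyclic group with generator \<open>g\<close>, a subgroup \<open>A\<close>
  of index \<open>d\<close> contains \<open>g [^] n\<close> exactly when \<open>d\<close> divides \<open>n\<close>, because the coset of \<open>g\<close>
  generates the quotient, which has order \<open>d\<close> (\<open>generator_pow_mem_iff\<close>). Under this dictionary
  an intersection of subgroups becomes a least common multiple of indices and the subgroup
  generated by a family becomes a greatest common divisor (\<open>cyclic_index_Int\<close>,
  \<open>cyclic_index_generate\<close>).

  The group is commutative, so a point of \<open>G/A\<close> has stabilizer \<open>A\<close> and a point of
  \<open>G/A \<times> G/B\<close> has stabilizer \<open>A \<inter> B\<close>. By the orbit-stabilizer theorem every orbit of the product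
  has \<open>lcm\<close> many points, and dividing the size of the product by this number leaves \<open>gcd\<close> many
  orbits.

  For the two global statements the isomorphism of the decomposition is never lifted to sets of
  orbits. A sum over orbits equals the sum over points in which each point is weighted by the
  inverse length of its orbit (\<open>sum_orbits_eq_weighted_sum\<close>). Both the weight and the summand
  (here the prime-to-\<open>p\<close> order, for any \<open>p\<close>) depend only on the
  stabilizer, and the bijection of the decomposition identifies the stabilizers of points
  (\<open>orbit_decomposition_stabilizer\<close>). A pair of indices then contributes
  \<open>l \<alpha> * l \<beta>\<close> points of weight \<open>1 / lcm (l \<alpha>) (l \<beta>)\<close>, that is \<open>gcd (l \<alpha>) (l \<beta>)\<close> in total. The
  orbit lengths are the numbers \<open>lcm (l \<alpha>) (l \<beta>)\<close>. Each is a multiple of some \<open>l \<alpha>\<close>, and the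
  pairs with \<open>\<alpha> = \<beta>\<close> give the \<open>l \<alpha>\<close> themselves, so both families have the same greatest
  common divisor.\<close>

section \<open>Subgroups of cyclic groups\<close>

lemma (in comm_group) subgroup_index_eq_order_Mod:
  assumes "subgroup A G"
  shows "subgroup_index G A = Coset.order (G Mod A)"
proof -
  interpret normal A G using assms by (rule subgroup_imp_normal)
  have "lcosets A = rcosets A"
    using coset_eq by (auto simp: LCOSETS_def RCOSETS_def)
  then show ?thesis
    by (simp add: subgroup_index_def Coset.order_def FactGroup_def)
qed

text \<open>The coset of \<open>g\<close> generates the quotient by \<open>A\<close>, so its order is the index of \<open>A\<close>. If the
  index is infinite, both sides say \<open>n = 0\<close>, since \<^const>\<open>card\<close> and \<^const>\<open>group.ord\<close> then vanish.\<close>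

lemma (in group) generator_pow_mem_iff:
  fixes n :: int
  assumes g: "g \<in> carrier G" "carrier G = range (\<lambda>n::int. g [^] n)"
    and A: "subgroup A G"
  shows "g [^] n \<in> A \<longleftrightarrow> int (subgroup_index G A) dvd n"
proof -
  interpret comm_group G
    using g cyclic_group cyclic_imp_abelian_group by blast
  interpret A: normal A G using A by (rule subgroup_imp_normal)
  interpret Q: group "G Mod A" by (rule A.factorgroup_is_group)
  let ?c = "A #> g"
  have c: "?c \<in> carrier (G Mod A)"
    using g by (auto simp: carrier_FactGroup)
  have "carrier (G Mod A) = (\<lambda>a. A #> a) ` range (\<lambda>n::int. g [^] n)"
    using g(2) by (simp add: carrier_FactGroup)
  also have "\<dots> = range (\<lambda>n::int. ?c [^]\<^bsub>G Mod A\<^esub> n)"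
    using g(1) by (simp add: image_image A.FactGroup_int_pow)
  also have "\<dots> = generate (G Mod A) {?c}"
    using Q.generate_pow[OF c] by auto
  finally have "Q.ord ?c = Coset.order (G Mod A)"
    using Q.generate_pow_card[OF c] by (simp add: Coset.order_def)
  then have ord: "Q.ord ?c = subgroup_index G A"
    by (simp add: subgroup_index_eq_order_Mod[OF A])
  have "g [^] n \<in> A \<longleftrightarrow> A #> (g [^] n) = A"
    using coset_join1[OF _ _ A] coset_join2[OF _ A] g(1) by auto
  also have "\<dots> \<longleftrightarrow> ?c [^]\<^bsub>G Mod A\<^esub> n = \<one>\<^bsub>G Mod A\<^esub>"
    using A.FactGroup_int_pow[OF g(1)] by simp
  also have "\<dots> \<longleftrightarrow> int (subgroup_index G A) dvd n"
    using Q.int_pow_eq_id[OF c] ord by simp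
  finally show ?thesis .
qed

lemma (in group) subgroup_index_eqI:
  assumes "g \<in> carrier G" "carrier G = range (\<lambda>n::int. g [^] n)" "subgroup A G"
    and "\<And>n::int. g [^] n \<in> A \<longleftrightarrow> int d dvd n"
  shows "subgroup_index G A = d"
proof -
  have "int (subgroup_index G A) dvd n \<longleftrightarrow> int d dvd n" for n
    using generator_pow_mem_iff[OF assms(1-3)] assms(4) by blast
  then show ?thesis
    by (metis dvd_antisym dvd_refl int_dvd_int_iff)
qed

lemma (in group) cyclic_index_Int:
  assumes "cyclic_group G" "subgroup A G" "subgroup B G"
  shows "subgroup_index G (A \<inter> B) = lcm (subgroup_index G A) (subgroup_index G B)"
proof -
  obtain g where g: "g \<in> carrier G" "carrier G = range (\<lambda>n::int. g [^] n)"
    using assms(1) cyclic_group by blast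
  show ?thesis
  proof (rule subgroup_index_eqI[OF g])
    show "subgroup (A \<inter> B) G"
      using assms(2,3) by (rule subgroups_Inter_pair)
    show "g [^] n \<in> A \<inter> B \<longleftrightarrow>
        int (lcm (subgroup_index G A) (subgroup_index G B)) dvd n" for n :: int
      using generator_pow_mem_iff[OF g] assms(2,3)
      by (simp add: lcm_int_int_eq[symmetric] del: lcm_int_int_eq)
  qed
qed

text \<open>The exponents of elements of the join are sums of multiples of the single indices, hence
  multiples of their greatest common divisor; conversely, the index of the join divides each of
  them. The family must be nonempty if the group is finite: the subgroup generated by the empty
  set is trivial, with index \<^term>\<open>Coset.order G\<close>, whereas the empty \<^const>\<open>Gcd\<close> is \<open>0\<close>.\<close>

lemma (in group) cyclic_index_generate:
  assumes "cyclic_group G" "I \<noteq> {}" and A: "\<And>i. i \<in> I \<Longrightarrow> subgroup (A i) G"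
  shows "subgroup_index G (generate G (\<Union>i\<in>I. A i)) = (GCD i\<in>I. subgroup_index G (A i))"
    (is "subgroup_index G ?J = ?d")
proof -
  obtain g where g: "g \<in> carrier G" "carrier G = range (\<lambda>n::int. g [^] n)"
    using assms(1) cyclic_group by blast
  have sub: "(\<Union>i\<in>I. A i) \<subseteq> carrier G"
    using A subgroup.subset by blast
  have J: "subgroup ?J G"
    using sub by (rule generate_is_subgroup)
  have mem: "int ?d dvd n" if "g [^] n \<in> A i" "i \<in> I" for n :: int and i
  proof -
    have "?d dvd subgroup_index G (A i)"
      using that(2) by (intro Gcd_dvd imageI)
    then show ?thesis
      using that generator_pow_mem_iff[OF g A] by (meson dvd_trans int_dvd_int_iff)
  qed
  have one: "int ?d dvd n" if "g [^] n = \<one>" for n :: int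
    using assms(2) mem that subgroup.one_closed[OF A] by (metis equals0I)
  \<comment> \<open>Exponents are only determined modulo the order of \<open>g\<close>, hence the quantifier over all
    exponents of the given element.\<close>
  have dvd: "\<forall>n::int. x = g [^] n \<longrightarrow> int ?d dvd n" if "x \<in> ?J" for x
    using that
  proof (induction rule: generate.induct)
    case one
    then show ?case using \<open>\<And>n. g [^] n = \<one> \<Longrightarrow> int ?d dvd n\<close> by metis
  next
    case (incl h)
    then show ?case using mem by blast
  next
    case (inv h)
    then show ?case using mem subgroup.m_inv_closed[OF A] by (metis UN_E)
  next
    case (eng h1 h2)
    have "h1 \<in> carrier G" "h2 \<in> carrier G"
      using eng.hyps generate_in_carrier[OF sub] by auto
    then obtain a b :: int where ab: "h1 = g [^] a" "h2 = g [^] b"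
      using g(2) by blast
    show ?case
    proof (intro allI impI)
      fix n :: int assume n: "h1 \<otimes> h2 = g [^] n"
      then have "g [^] (n - (a + b)) = \<one>"
        using g(1) ab by (simp add: int_pow_diff int_pow_mult)
      then have "int ?d dvd n - (a + b)" by (rule one)
      moreover have "int ?d dvd a + b"
        using eng.IH ab by (intro dvd_add) auto
      ultimately show "int ?d dvd n"
        by (metis dvd_add diff_add_cancel)
    qed
  qed
  show ?thesis
  proof (rule dvd_antisym)
    show "subgroup_index G ?J dvd ?d"
    proof (rule Gcd_greatest)
      fix b assume "b \<in> (\<lambda>i. subgroup_index G (A i)) ` I"
      then obtain i where i: "i \<in> I" "b = subgroup_index G (A i)" by blast
      have "g [^] int b \<in> A i"
        using generator_pow_mem_iff[OF g A[OF i(1)]] i(2) by simp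
      then have "g [^] int b \<in> ?J"
        using i(1) by (blast intro: generate.incl)
      then show "subgroup_index G ?J dvd b"
        using generator_pow_mem_iff[OF g J] by simp
    qed
    have "g [^] int (subgroup_index G ?J) \<in> ?J"
      using generator_pow_mem_iff[OF g J] by simp
    then show "?d dvd subgroup_index G ?J"
      using dvd by (metis int_dvd_int_iff)
  qed
qed

section \<open>Stabilizers\<close>

text \<open>The stabilizer of the coset \<open>a <# A\<close> is the conjugate of \<open>A\<close> by \<open>a\<close>, which is \<open>A\<close> itself in
  a commutative group.\<close>

lemma (in comm_group) stabilizer_coset_action:
  assumes A: "subgroup A G" and C: "C \<in> lcosets A"
  shows "stabilizer G (coset_action G A) C = A"
proof -
  obtain a where a: "a \<in> carrier G" "C = a <# A"
    using C by (auto simp: LCOSETS_def)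
  note sub = subgroup.subset[OF A]
  have "g <# C = C \<longleftrightarrow> g \<in> A" if g: "g \<in> carrier G" for g
  proof -
    have gC: "g <# C = a <# (g <# A)"
      using a g sub by (simp add: lcos_m_assoc m_comm)
    have "g \<in> A" if "a <# (g <# A) = a <# A"
    proof -
      have "a \<otimes> g \<in> a <# (g <# A)"
        using lcos_self[OF g A] unfolding l_coset_def by blast
      then have "a \<otimes> g \<in> a <# A"
        by (simp only: that)
      then show ?thesis
        using a g sub by (auto simp: l_coset_def)
    qed
    then show ?thesis
      using gC a(2) coset_join3[OF g A] by auto
  qed
  then show ?thesis
    using C sub by (auto simp: stabilizer_def coset_action_def)
qed

lemma stabilizer_diagonal_action:
  assumes "x \<in> E" "y \<in> F"
  shows "stabilizer G (diagonal_action E \<phi> F \<psi>) (x, y) = stabilizer G \<phi> x \<inter> stabilizer G \<psi> y"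
  using assms by (auto simp: stabilizer_def diagonal_action_def)

lemma stabilizer_coproduct_action:
  assumes "i \<in> I" "x \<in> E i"
  shows "stabilizer G (coproduct_action I E \<phi>) (i, x) = stabilizer G (\<phi> i) x"
  using assms by (auto simp: stabilizer_def coproduct_action_def)

lemma stabilizer_gset_iso:
  assumes "group_action G E \<phi>" "gset_iso G E \<phi> F \<psi> f" "x \<in> E"
  shows "stabilizer G \<psi> (f x) = stabilizer G \<phi> x"
proof -
  have "\<psi> g (f x) = f x \<longleftrightarrow> \<phi> g x = x" if "g \<in> carrier G" for g
  proof -
    have "\<psi> g (f x) = f (\<phi> g x)"
      using assms(2,3) that by (simp add: gset_iso_def)
    moreover have "inj_on f E"
      using assms(2) by (simp add: gset_iso_def bij_betw_def)
    ultimately show ?thesis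
      using assms(3) group_actionE(2)[OF assms(1) that] by (simp add: inj_on_eq_iff)
  qed
  then show ?thesis by (auto simp: stabilizer_def)
qed

text \<open>Orbit lengths are determined by stabilizers, so this is all that counting orbits requires
  of a decomposition.\<close>

lemma (in comm_group) orbit_decomposition_stabilizer:
  assumes "orbit_decomposition G E \<phi> I H"
  obtains f where "bij_betw f (SIGMA \<alpha>:I. lcosets (H \<alpha>)) E"
    and "\<And>\<alpha> C. \<alpha> \<in> I \<Longrightarrow> C \<in> lcosets (H \<alpha>) \<Longrightarrow> stabilizer G \<phi> (f (\<alpha>, C)) = H \<alpha>"
proof -
  let ?S = "SIGMA \<alpha>:I. lcosets (H \<alpha>)"
  let ?\<psi> = "coproduct_action I (\<lambda>\<alpha>. lcosets (H \<alpha>)) (\<lambda>\<alpha>. coset_action G (H \<alpha>))"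
  have H: "subgroup (H \<alpha>) G" if "\<alpha> \<in> I" for \<alpha>
    using assms that by (simp add: orbit_decomposition_def)
  obtain f where f: "gset_iso G ?S ?\<psi> E \<phi> f"
    using assms by (auto simp: orbit_decomposition_def)
  have act: "group_action G ?S ?\<psi>"
    using H by (intro group_action_coproduct_action group_action_coset_action is_group)
  show thesis
  proof (rule that)
    show "bij_betw f ?S E" using f by (simp add: gset_iso_def)
    show "stabilizer G \<phi> (f (\<alpha>, C)) = H \<alpha>" if "\<alpha> \<in> I" "C \<in> lcosets (H \<alpha>)" for \<alpha> C
      using stabilizer_gset_iso[OF act f, of "(\<alpha>, C)"] that
        stabilizer_coset_action[OF H[OF that(1)] that(2)]
        stabilizer_coproduct_action[of \<alpha> I C "\<lambda>\<alpha>. lcosets (H \<alpha>)" G "\<lambda>\<alpha>. coset_action G (H \<alpha>)"]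
      by auto
  qed
qed

section \<open>Orbit lengths and sums over orbits\<close>

lemma (in group) subgroup_index_pos:
  assumes "finite (carrier G)" "subgroup A G"
  shows "subgroup_index G A > 0"
  using l_lagrange[OF assms] order_gt_0_iff_finite assms(1)
  by (metis gr0I mult_0 subgroup_index_def less_irrefl)

lemma (in group_action) card_orbit_eq_subgroup_index:
  assumes "finite (carrier G)" "x \<in> E"
  shows "card (orbit G \<phi> x) = subgroup_index G (stabilizer G \<phi> x)"
proof -
  interpret group G using group_hom group_hom.axioms(1) by blast
  have sub: "subgroup (stabilizer G \<phi> x) G"
    using assms(2) by (rule stabilizer_subgroup)
  have "card (orbit G \<phi> x) * card (stabilizer G \<phi> x) =
      subgroup_index G (stabilizer G \<phi> x) * card (stabilizer G \<phi> x)"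
    using orbit_stabilizer_theorem[OF assms(2)] l_lagrange[OF assms(1) sub]
    by (simp add: subgroup_index_def)
  moreover have "card (stabilizer G \<phi> x) > 0"
    using subgroup.finite_imp_card_positive[OF sub assms(1)] .
  ultimately show ?thesis by simp
qed

lemma (in group_action) orbit_eq_of_mem:
  assumes "Orb \<in> orbits G E \<phi>" "x \<in> Orb"
  shows "x \<in> E" "orbit G \<phi> x = Orb"
proof -
  show x: "x \<in> E" using assms orbits_coverture by blast
  then have "orbit G \<phi> x \<in> orbits G E \<phi>" by (auto simp: orbits_def)
  then show "orbit G \<phi> x = Orb"
    using disjoint_union[OF _ assms(1)] orbit_refl[OF x] assms(2) by blast
qed

text \<open>Each orbit contributes its value once, spread evenly over its points.\<close>

lemma (in group_action) sum_orbits_eq_weighted_sum: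
  fixes h :: "'c set \<Rightarrow> real"
  assumes "finite E"
  shows "(\<Sum>Orb \<in> orbits G E \<phi>. h Orb) = (\<Sum>x \<in> E. h (orbit G \<phi> x) / card (orbit G \<phi> x))"
proof -
  have "h Orb = (\<Sum>x \<in> Orb. h (orbit G \<phi> x) / card (orbit G \<phi> x))"
    if Orb: "Orb \<in> orbits G E \<phi>" for Orb
  proof -
    have "Orb \<subseteq> E"
      using Orb orbits_coverture by blast
    then have "finite Orb"
      using assms by (rule finite_subset)
    moreover have "Orb \<noteq> {}"
      using Orb orbit_refl by (auto simp: orbits_def)
    ultimately have "card Orb \<noteq> 0" by simp
    then show ?thesis using orbit_eq_of_mem(2)[OF Orb] by simp
  qed
  then have "(\<Sum>Orb \<in> orbits G E \<phi>. h Orb) =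
      (\<Sum>Orb \<in> orbits G E \<phi>. \<Sum>x \<in> Orb. h (orbit G \<phi> x) / card (orbit G \<phi> x))"
    by (rule sum.cong[OF refl])
  then show ?thesis using disjoint_sum[OF assms] by simp
qed

section \<open>The orbits on pairs\<close>

lemma (in group) product_of_cosets_orbits:
  assumes "cyclic_group G" and fin: "finite (carrier G)"
    and A: "subgroup A G" and B: "subgroup B G"
  defines "\<psi> \<equiv> diagonal_action (lcosets A) (coset_action G A) (lcosets B) (coset_action G B)"
  shows "z \<in> (lcosets A) \<times> (lcosets B) \<Longrightarrow> stabilizer G \<psi> z = A \<inter> B"
    and "z \<in> (lcosets A) \<times> (lcosets B) \<Longrightarrow>
      card (orbit G \<psi> z) = lcm (subgroup_index G A) (subgroup_index G B)"
    and "card (orbits G ((lcosets A) \<times> (lcosets B)) \<psi>) = gcd (subgroup_index G A) (subgroup_index G B)"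
proof -
  interpret comm_group G using assms(1) cyclic_imp_abelian_group by blast
  let ?P = "(lcosets A) \<times> (lcosets B)" and ?a = "subgroup_index G A" and ?b = "subgroup_index G B"
  interpret P: group_action G ?P \<psi>
    unfolding \<psi>_def
    by (intro group_action_diagonal_action group_action_coset_action is_group A B)
  show stab: "stabilizer G \<psi> z = A \<inter> B" if "z \<in> ?P" for z
    using that stabilizer_coset_action A B unfolding \<psi>_def
    by (auto simp: stabilizer_diagonal_action)
  show len: "card (orbit G \<psi> z) = lcm ?a ?b" if "z \<in> ?P" for z
    using P.card_orbit_eq_subgroup_index[OF fin that] stab[OF that]
      cyclic_index_Int[OF assms(1) A B] by simp
  have pos: "?a > 0" "?b > 0" using subgroup_index_pos[OF fin] A B by auto
  then have finP: "finite ?P"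
    by (auto simp: subgroup_index_def intro: card_ge_0_finite)
  have "real (card (orbits G ?P \<psi>)) = (\<Sum>z \<in> ?P. 1 / real (lcm ?a ?b))"
    using P.sum_orbits_eq_weighted_sum[OF finP, of "\<lambda>_. 1"] len by simp
  also have "\<dots> = real (?a * ?b) / real (lcm ?a ?b)"
    by (simp add: card_cartesian_product subgroup_index_def)
  also have "real (?a * ?b) = real (gcd ?a ?b) * real (lcm ?a ?b)"
    by (metis of_nat_mult prod_gcd_lcm_nat)
  finally show "card (orbits G ?P \<psi>) = gcd ?a ?b"
    using pos by simp
qed

theorem proposition4p4:
  fixes G :: "('a, 'b) monoid_scheme" (structure)
    and m :: nat
    and E :: "'x set"
    and \<phi> :: "'a \<Rightarrow> 'x \<Rightarrow> 'x"
    and I :: "'i set"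
    and H :: "'i \<Rightarrow> 'a set"
    and l :: "'i \<Rightarrow> nat"
  assumes "m \<ge> 2"
    and "group G" and "cyclic_group G" and "Coset.order G = m"
    and "group_action G E \<phi>" and "finite E" and "E \<noteq> {}"
    and "orbit_decomposition G E \<phi> I H"
    and "\<And>\<alpha>. \<alpha> \<in> I \<Longrightarrow> l \<alpha> = subgroup_index G (H \<alpha>)"
  shows
    "(\<forall>\<alpha> \<in> I. \<forall>\<beta> \<in> I.
        let P = (lcosets (H \<alpha>)) \<times> (lcosets (H \<beta>));
            \<psi> = diagonal_action (lcosets (H \<alpha>)) (coset_action G (H \<alpha>))
                                (lcosets (H \<beta>)) (coset_action G (H \<beta>))
        in card (orbits G P \<psi>) = gcd (l \<alpha>) (l \<beta>) \<and>
           (\<forall>Orb \<in> orbits G P \<psi>. card Orb = lcm (l \<alpha>) (l \<beta>) \<and>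
              (\<forall>z \<in> Orb. stabilizer G \<psi> z = H \<alpha> \<inter> H \<beta>)))
     \<and> pair_orbit_gcd G E \<phi> = Gcd (l ` I)
     \<and> Gcd (l ` I) = subgroup_index G (generate G (\<Union>\<alpha> \<in> I. H \<alpha>))
     \<and> pair_orbit_number CHAR('k::alg_closed_field) G E \<phi> =
         (\<Sum>\<alpha> \<in> I. \<Sum>\<beta> \<in> I.
            gcd (l \<alpha>) (l \<beta>) * prime_to_order CHAR('k) (G\<lparr>carrier := H \<alpha> \<inter> H \<beta>\<rparr>))"
proof -
  interpret group G by fact
  interpret comm_group G using assms(3) cyclic_imp_abelian_group by blast
  have fin: "finite (carrier G)"
    using assms(1,4) order_gt_0_iff_finite by simp
  have H: "subgroup (H \<alpha>) G" if "\<alpha> \<in> I" for \<alpha>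
    using assms(8) that by (simp add: orbit_decomposition_def)
  have l: "l \<alpha> = subgroup_index G (H \<alpha>)" if "\<alpha> \<in> I" for \<alpha>
    using assms(9) that .
  have lpos: "l \<alpha> > 0" if "\<alpha> \<in> I" for \<alpha>
    using subgroup_index_pos[OF fin H] l that by simp
  have cardl: "card (lcosets (H \<alpha>)) = l \<alpha>" if "\<alpha> \<in> I" for \<alpha>
    using l[OF that] by (simp add: subgroup_index_def)

  have parts: "let P = (lcosets (H \<alpha>)) \<times> (lcosets (H \<beta>));
            \<psi> = diagonal_action (lcosets (H \<alpha>)) (coset_action G (H \<alpha>))
                                (lcosets (H \<beta>)) (coset_action G (H \<beta>))
        in card (orbits G P \<psi>) = gcd (l \<alpha>) (l \<beta>) \<and>
           (\<forall>Orb \<in> orbits G P \<psi>. card Orb = lcm (l \<alpha>) (l \<beta>) \<and>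
              (\<forall>z \<in> Orb. stabilizer G \<psi> z = H \<alpha> \<inter> H \<beta>))"
    if \<alpha>: "\<alpha> \<in> I" and \<beta>: "\<beta> \<in> I" for \<alpha> \<beta>
  proof -
    let ?P = "(lcosets (H \<alpha>)) \<times> (lcosets (H \<beta>))"
    let ?\<psi> = "diagonal_action (lcosets (H \<alpha>)) (coset_action G (H \<alpha>))
                                (lcosets (H \<beta>)) (coset_action G (H \<beta>))"
    note facts = product_of_cosets_orbits[OF assms(3) fin H[OF \<alpha>] H[OF \<beta>]]
    interpret P: group_action G ?P ?\<psi>
      by (intro group_action_diagonal_action group_action_coset_action is_group H \<alpha> \<beta>)
    have "card Orb = lcm (l \<alpha>) (l \<beta>)" if "Orb \<in> orbits G ?P ?\<psi>" for Orb
      using that facts(2) l \<alpha> \<beta> by (auto simp: orbits_def)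
    moreover have "stabilizer G ?\<psi> z = H \<alpha> \<inter> H \<beta>" if "Orb \<in> orbits G ?P ?\<psi>" "z \<in> Orb" for Orb z
      using facts(1) P.orbit_eq_of_mem(1)[OF that] by blast
    ultimately show ?thesis
      unfolding Let_def using facts(3) l \<alpha> \<beta> by simp
  qed

  obtain f where bij: "bij_betw f (SIGMA \<alpha>:I. lcosets (H \<alpha>)) E"
    and stab: "\<And>\<alpha> C. \<alpha> \<in> I \<Longrightarrow> C \<in> lcosets (H \<alpha>) \<Longrightarrow> stabilizer G \<phi> (f (\<alpha>, C)) = H \<alpha>"
    using orbit_decomposition_stabilizer[OF assms(8)] by metis
  let ?S = "SIGMA \<alpha>:I. lcosets (H \<alpha>)"
  have finS: "finite ?S"
    using bij assms(6) bij_betw_finite by blast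
  have ne: "lcosets (H \<alpha>) \<noteq> {}" if "\<alpha> \<in> I" for \<alpha>
    using cardl[OF that] lpos[OF that] by auto
  have "fst ` ?S = I" using ne by force
  then have finI: "finite I" using finS by (metis finite_imageI)
  have finC: "finite (lcosets (H \<alpha>))" if "\<alpha> \<in> I" for \<alpha>
    using cardl[OF that] lpos[OF that] by (simp add: card_ge_0_finite)
  have "?S \<noteq> {}" using bij assms(7) by (auto simp: bij_betw_def)
  then have I_ne: "I \<noteq> {}" by auto

  let ?\<psi> = "diagonal_action E \<phi> E \<phi>"
  interpret D: group_action G "E \<times> E" ?\<psi>
    using assms(5) by (intro group_action_diagonal_action)
  have fE: "f z \<in> E" if "z \<in> ?S" for z
    using bij that by (auto simp: bij_betw_def)
  have dstab: "stabilizer G ?\<psi> (f (\<alpha>, C), f (\<beta>, C')) = H \<alpha> \<inter> H \<beta>"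
    if "\<alpha> \<in> I" "C \<in> lcosets (H \<alpha>)" "\<beta> \<in> I" "C' \<in> lcosets (H \<beta>)" for \<alpha> C \<beta> C'
    using that fE stab by (simp add: stabilizer_diagonal_action)
  have dlen: "card (orbit G ?\<psi> (f (\<alpha>, C), f (\<beta>, C'))) = lcm (l \<alpha>) (l \<beta>)"
    if "\<alpha> \<in> I" "C \<in> lcosets (H \<alpha>)" "\<beta> \<in> I" "C' \<in> lcosets (H \<beta>)" for \<alpha> C \<beta> C'
    using D.card_orbit_eq_subgroup_index[OF fin] fE dstab that
      cyclic_index_Int[OF assms(3) H H] l by simp

  have "pair_orbit_gcd G E \<phi> = Gcd (l ` I)"
  proof -
    have lens: "{card Orb | Orb. Orb \<in> pair_orbits G E \<phi>} = {lcm (l \<alpha>) (l \<beta>) | \<alpha> \<beta>. \<alpha> \<in> I \<and> \<beta> \<in> I}"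
      (is "?L = ?R")
    proof (intro equalityI subsetI)
      fix n assume "n \<in> ?L"
      then obtain x y where xy: "x \<in> E" "y \<in> E" "n = card (orbit G ?\<psi> (x, y))"
        by (auto simp: orbits_def)
      then obtain \<alpha> C \<beta> C' where "\<alpha> \<in> I" "C \<in> lcosets (H \<alpha>)" "x = f (\<alpha>, C)"
          "\<beta> \<in> I" "C' \<in> lcosets (H \<beta>)" "y = f (\<beta>, C')"
        using bij unfolding bij_betw_def by blast
      then show "n \<in> ?R" using xy(3) dlen by blast
    next
      fix n assume "n \<in> ?R"
      then obtain \<alpha> \<beta> where ab: "\<alpha> \<in> I" "\<beta> \<in> I" "n = lcm (l \<alpha>) (l \<beta>)" by blast
      then obtain C C' where C: "C \<in> lcosets (H \<alpha>)" "C' \<in> lcosets (H \<beta>)" using ne by blast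
      have "orbit G ?\<psi> (f (\<alpha>, C), f (\<beta>, C')) \<in> pair_orbits G E \<phi>"
        using ab C fE by (auto simp: orbits_def)
      then show "n \<in> ?L" using dlen[OF ab(1) C(1) ab(2) C(2)] ab(3) by force
    qed
    show ?thesis
      unfolding pair_orbit_gcd_def lens
    proof (rule dvd_antisym)
      show "Gcd ?R dvd Gcd (l ` I)"
      proof (rule Gcd_greatest)
        fix n assume "n \<in> l ` I"
        then obtain \<alpha> where "\<alpha> \<in> I" "n = lcm (l \<alpha>) (l \<alpha>)" by auto
        then show "Gcd ?R dvd n" by (intro Gcd_dvd) blast
      qed
      show "Gcd (l ` I) dvd Gcd ?R"
        by (rule Gcd_greatest) (auto intro: dvd_trans[OF Gcd_dvd dvd_lcm1])
    qed
  qed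
  moreover have "Gcd (l ` I) = subgroup_index G (generate G (\<Union>\<alpha> \<in> I. H \<alpha>))"
    using cyclic_index_generate[OF assms(3) I_ne H] l by simp
  moreover have "pair_orbit_number p G E \<phi> =
      (\<Sum>\<alpha> \<in> I. \<Sum>\<beta> \<in> I. gcd (l \<alpha>) (l \<beta>) * prime_to_order p (G\<lparr>carrier := H \<alpha> \<inter> H \<beta>\<rparr>))" for p
  proof -
    have sum_S: "(\<Sum>s \<in> ?S. F s) = (\<Sum>\<alpha> \<in> I. \<Sum>C \<in> lcosets (H \<alpha>). F (\<alpha>, C))"
      for F :: "'i \<times> 'a set \<Rightarrow> real"
      using finI finC by (simp add: sum.Sigma)
    define w where "w A = real (prime_to_order p (G\<lparr>carrier := A\<rparr>))" for A
    define v where "v z = w (stabilizer G ?\<psi> z) / card (orbit G ?\<psi> z)" for z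
    have "real (pair_orbit_number p G E \<phi>) =
        (\<Sum>Orb \<in> pair_orbits G E \<phi>. w (orbit_stabilizer G ?\<psi> Orb))"
      by (simp add: pair_orbit_number_def w_def)
    also have "\<dots> = (\<Sum>z \<in> E \<times> E. w (orbit_stabilizer G ?\<psi> (orbit G ?\<psi> z)) / card (orbit G ?\<psi> z))"
      using assms(6) by (intro D.sum_orbits_eq_weighted_sum) simp
    also have "\<dots> = (\<Sum>z \<in> E \<times> E. v z)"
    proof (rule sum.cong[OF refl])
      fix z assume z: "z \<in> E \<times> E"
      then have "orbit G ?\<psi> z \<in> pair_orbits G E \<phi>" by (auto simp: orbits_def)
      then have "orbit_stabilizer G ?\<psi> (orbit G ?\<psi> z) = stabilizer G ?\<psi> z"
        using D.orbit_refl[OF z]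
        by (intro orbit_stabilizer_eq[OF comm_group_axioms D.group_action_axioms])
      then show "w (orbit_stabilizer G ?\<psi> (orbit G ?\<psi> z)) / card (orbit G ?\<psi> z) = v z"
        by (simp add: v_def)
    qed
    also have "\<dots> = (\<Sum>x \<in> E. \<Sum>y \<in> E. v (x, y))"
      by (simp add: sum.cartesian_product)
    also have "\<dots> = (\<Sum>s \<in> ?S. \<Sum>t \<in> ?S. v (f s, f t))"
      by (simp add: sum.reindex_bij_betw[OF bij, symmetric])
    also have "\<dots> = (\<Sum>\<alpha> \<in> I. \<Sum>C \<in> lcosets (H \<alpha>). \<Sum>\<beta> \<in> I. \<Sum>C' \<in> lcosets (H \<beta>).
        v (f (\<alpha>, C), f (\<beta>, C')))"
      by (simp add: sum_S)
    also have "\<dots> = (\<Sum>\<alpha> \<in> I. \<Sum>C \<in> lcosets (H \<alpha>). \<Sum>\<beta> \<in> I. \<Sum>C' \<in> lcosets (H \<beta>).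
        w (H \<alpha> \<inter> H \<beta>) / lcm (l \<alpha>) (l \<beta>))"
      by (intro sum.cong refl) (simp add: v_def dstab dlen)
    also have "\<dots> = (\<Sum>\<alpha> \<in> I. \<Sum>\<beta> \<in> I. real (l \<alpha> * l \<beta>) * (w (H \<alpha> \<inter> H \<beta>) / lcm (l \<alpha>) (l \<beta>)))"
      by (simp add: cardl sum_distrib_left mult.assoc)
    also have "\<dots> = (\<Sum>\<alpha> \<in> I. \<Sum>\<beta> \<in> I. real (gcd (l \<alpha>) (l \<beta>)) * w (H \<alpha> \<inter> H \<beta>))"
    proof (intro sum.cong refl)
      fix \<alpha> \<beta> assume "\<alpha> \<in> I" "\<beta> \<in> I"
      then have "l \<alpha> > 0" "l \<beta> > 0"
        using lpos by auto
      moreover have "real (l \<alpha> * l \<beta>) = real (gcd (l \<alpha>) (l \<beta>)) * real (lcm (l \<alpha>) (l \<beta>))"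
        by (metis of_nat_mult prod_gcd_lcm_nat)
      ultimately show "real (l \<alpha> * l \<beta>) * (w (H \<alpha> \<inter> H \<beta>) / lcm (l \<alpha>) (l \<beta>)) =
          real (gcd (l \<alpha>) (l \<beta>)) * w (H \<alpha> \<inter> H \<beta>)"
        by simp
    qed
    finally have "real (pair_orbit_number p G E \<phi>) = real (\<Sum>\<alpha> \<in> I. \<Sum>\<beta> \<in> I.
        gcd (l \<alpha>) (l \<beta>) * prime_to_order p (G\<lparr>carrier := H \<alpha> \<inter> H \<beta>\<rparr>))"
      by (simp add: w_def)
    then show ?thesis by (simp only: of_nat_eq_iff)
  qed
  ultimately show ?thesis
    using parts by blast
qed

end
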